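(* Let $\{(G_i,\theta_i^* )\}_{i=1}^M$ be an exchangeable validation set. Define the nonconformity score $$s(G)=(\theta^*(G)-\mu(G))^\top\Sigma^{-1}(G)\,(\theta^*(G)-\mu(G)).$$ Let $k=\lceil(M+1)(1-\alpha)\rceil$, and let $\hat q_{1-\alpha}$ be the $k$-th order statistic of $\{s(G_i)\}_{i=1}^M$. Then for any new exchangeable test instance $G_{M+1}$, $$\mathbb{P}\bigl[\theta^*(G_{M+1})\in\mathcal{T}_{\hat q_{1-\alpha}}(G_{M+1})\bigr]\ge 1-\alpha,$$ where $$\mathcal{T}_q(G)=\{\theta:(\theta-\mu)^\top\Sigma^{-1}(\theta-\mu)\le q\},\qquad \mu=\mu(G),\ \Sigma=\Sigma(G).$$ The coverage statement applies to the target optima $\theta_i^*$ described in the context.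
   Context: The setting is the depth-$p$ Quantum Approximate Optimization Algorithm (QAOA) for unweighted MaxCut. For a graph $G$ on $n$ vertices with edge set $E$, let $C=\sum_{(i,j)\in E}\frac12(I-Z_iZ_j)$ and $B=\sum_i X_i$, where $Z_i,X_i$ are Pauli operators on qubit $i$. For angles $\theta=(\gamma,\beta)\in\mathbb{R}^{2p}$, let $|\theta\rangle=e^{-i\beta_pB}e^{-i\gamma_pC}\cdots e^{-i\beta_1B}e^{-i\gamma_1C}|+\rangle^{\otimes n}$. The objective is $F_G(\theta)=\langle\theta|C|\theta\rangle$, to be maximized. The target optimum $\theta^*(G)\in\mathbb{R}^{2p}$ is the approximate local optimum of $F_G$ produced by multi-restart Nelder–Mead optimization of the exact statevector objective (not guaranteed to be a global optimum), and $\theta_i^*=\theta^*(G_i)$. A learned predictor (a graph neural network) maps each graph $G$ to the mean $\mu(G)\in\mathbb{R}^{2p}$ and the symmetric positive definite covariance $\Sigma(G)\in\mathbb{R}^{2p\times 2p}$ of a Gaussian over QAOA angles. Here $\alpha\in(0,1)$. That the test instance is exchangeable means that the $M+1$ pairs $\{(G_i,\theta_i^* )\}_{i=1}^{M+1}$ are exchangeable. The $k$-th order statistic is the $k$-th smallest value. *)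

theory Defs
  imports "HOL-Probability.Probability" "HOL-Combinatorics.Permutations"
begin

section \<open>Graphs\<close>

text \<open>
  A graph is a number \<open>n\<close> of vertices together with an edge set on the vertices \<open>0, \<dots>, n - 1\<close>;
  the undirected edge joining \<open>i\<close> and \<open>j\<close> is represented once, by the pair with \<open>i < j\<close>.
  The number of vertices may differ from graph to graph.
\<close>

type_synonym ugraph = "nat \<times> (nat \<times> nat) set"

definition graphs :: "ugraph set" where
  "graphs = {(n, E). 0 < n \<and> E \<subseteq> {(i, j). i < j \<and> j < n}}"


section \<open>The QAOA objective for MaxCut\<close>

text \<open>
  The computational basis state of \<open>n\<close> qubits in which exactly the qubits in \<open>x \<subseteq> {..<n}\<close> have
  value 1 is identified with the set \<open>x\<close>; a state is its family of amplitudes.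
\<close>

type_synonym qstate = "nat set \<Rightarrow> complex"

definition pauli_Z :: "nat \<Rightarrow> qstate \<Rightarrow> qstate" where
  "pauli_Z i \<psi> = (\<lambda>x. if i \<in> x then - \<psi> x else \<psi> x)"

definition pauli_X :: "nat \<Rightarrow> qstate \<Rightarrow> qstate" where
  "pauli_X i \<psi> = (\<lambda>x. \<psi> (if i \<in> x then x - {i} else insert i x))"

definition cost_op :: "ugraph \<Rightarrow> qstate \<Rightarrow> qstate" where
  "cost_op G \<psi> = (\<lambda>x. \<Sum>(i, j)\<in>snd G. 1 / 2 * (\<psi> x - pauli_Z i (pauli_Z j \<psi>) x))"

definition mixer_op :: "ugraph \<Rightarrow> qstate \<Rightarrow> qstate" where
  "mixer_op G \<psi> = (\<lambda>x. \<Sum>i<fst G. pauli_X i \<psi> x)"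

text \<open>\<open>op_exp c A\<close> is the operator exponential \<open>exp (c A)\<close>, given by its power series.\<close>

definition op_exp :: "complex \<Rightarrow> (qstate \<Rightarrow> qstate) \<Rightarrow> qstate \<Rightarrow> qstate" where
  "op_exp c A \<psi> = (\<lambda>x. \<Sum>k. c ^ k / fact k * (A ^^ k) \<psi> x)"

definition plus_state :: "ugraph \<Rightarrow> qstate" where
  "plus_state G = (\<lambda>x. if x \<subseteq> {..<fst G} then complex_of_real (1 / sqrt (2 ^ fst G)) else 0)"

text \<open>
  Depth \<open>p = CARD('p)\<close>: the layers are the elements of \<open>'p\<close> in increasing order, and
  \<open>\<theta> = (\<gamma>, \<beta>)\<close> has \<open>\<gamma>\<close> as its \<open>Inl\<close> half and \<open>\<beta>\<close> as its \<open>Inr\<close> half.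
\<close>

type_synonym 'p angles = "real ^ ('p + 'p)"

definition qaoa_state :: "ugraph \<Rightarrow> 'p::{finite,linorder} angles \<Rightarrow> qstate" where
  "qaoa_state G \<theta> =
     fold (\<lambda>l \<psi>. op_exp (- \<i> * complex_of_real (\<theta> $ Inr l)) (mixer_op G)
                   (op_exp (- \<i> * complex_of_real (\<theta> $ Inl l)) (cost_op G) \<psi>))
       (sorted_list_of_set (UNIV :: 'p set)) (plus_state G)"

text \<open>The expectation of the Hermitian operator \<open>C\<close> is real, so taking the real part loses nothing.\<close>

definition qaoa_objective :: "ugraph \<Rightarrow> 'p::{finite,linorder} angles \<Rightarrow> real" where
  "qaoa_objective G \<theta> =
     Re (\<Sum>x\<in>Pow {..<fst G}. cnj (qaoa_state G \<theta> x) * cost_op G (qaoa_state G \<theta>) x)"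


section \<open>Multi-restart Nelder--Mead\<close>

text \<open>
  The hyperparameters of the optimizer are left general. The initial simplices of the restarts may
  depend on the graph. The stopping test sees the function being minimized and all simplices so
  far (most recent first); \<open>nm_maxiter\<close> bounds the number of iterations of a single run.
\<close>

record 'a nm_config =
  nm_reflect :: real
  nm_expand :: real
  nm_contract :: real
  nm_shrink :: real
  nm_stop :: "('a \<Rightarrow> real) \<Rightarrow> 'a list list \<Rightarrow> bool"
  nm_maxiter :: nat
  nm_starts :: "ugraph \<Rightarrow> 'a list list"

definition valid_nm_config :: "'a::euclidean_space nm_config \<Rightarrow> bool" where
  "valid_nm_config c \<longleftrightarrow>
     0 < nm_reflect c \<and> 1 < nm_expand c \<and> nm_reflect c < nm_expand c \<and>
     0 < nm_contract c \<and> nm_contract c < 1 \<and> 0 < nm_shrink c \<and> nm_shrink c < 1 \<and>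
     (\<forall>G\<in>graphs. nm_starts c G \<noteq> [] \<and>
        (\<forall>S\<in>set (nm_starts c G). length S = Suc DIM('a) \<and> distinct S \<and> \<not> affine_dependent (set S)))"

text \<open>
  One iteration for the minimization of \<open>f\<close>, after Lagarias, Reeds, Wright and Wright (1998).
  A simplex is the list of its vertices in order of increasing \<open>f\<close>. Since \<open>sort_key\<close> is stable,
  among equal values the new vertex is ranked last and, after a shrink, the old best vertex first.
\<close>

definition nm_step :: "'a::euclidean_space nm_config \<Rightarrow> ('a \<Rightarrow> real) \<Rightarrow> 'a list \<Rightarrow> 'a list" where
  "nm_step c f S =
     (let best = hd S; worst = last S; rest = butlast S; second_worst = last rest;
          cen = (1 / real (length rest)) *\<^sub>R sum_list rest;
          xr = cen + nm_reflect c *\<^sub>R (cen - worst);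
          xe = cen + nm_expand c *\<^sub>R (xr - cen);
          xo = cen + nm_contract c *\<^sub>R (xr - cen);
          xi = cen - nm_contract c *\<^sub>R (cen - worst);
          shrunk = best # map (\<lambda>x. best + nm_shrink c *\<^sub>R (x - best)) (tl S)
      in sort_key f
          (if f xr < f best then rest @ [if f xe < f xr then xe else xr]
           else if f xr < f second_worst then rest @ [xr]
           else if f xr < f worst then (if f xo \<le> f xr then rest @ [xo] else shrunk)
           else (if f xi < f worst then rest @ [xi] else shrunk)))"

primrec nm_iterate ::
  "'a::euclidean_space nm_config \<Rightarrow> ('a \<Rightarrow> real) \<Rightarrow> nat \<Rightarrow> 'a list list \<Rightarrow> 'a list" where
  "nm_iterate c f 0 hist = hd hist"
| "nm_iterate c f (Suc N) hist =
     (if nm_stop c f hist then hd hist else nm_iterate c f N (nm_step c f (hd hist) # hist))"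

definition nm_run :: "'a::euclidean_space nm_config \<Rightarrow> ('a \<Rightarrow> real) \<Rightarrow> 'a list \<Rightarrow> 'a" where
  "nm_run c f S = hd (nm_iterate c f (nm_maxiter c) [sort_key f S])"

text \<open>Maximizing the objective is minimizing its negative; the best restart is returned.\<close>

definition target_optimum ::
  "'p::{finite,linorder} angles nm_config \<Rightarrow> ugraph \<Rightarrow> 'p angles" where
  "target_optimum c G =
     (let f = (\<lambda>\<theta>. - qaoa_objective G \<theta>)
      in arg_min_list f (map (nm_run c f) (nm_starts c G)))"


section \<open>Conformal prediction\<close>

definition sym_pos_def :: "real ^ 'd ^ 'd \<Rightarrow> bool" where
  "sym_pos_def A \<longleftrightarrow> transpose A = A \<and> (\<forall>x. x \<noteq> 0 \<longrightarrow> 0 < x \<bullet> (A *v x))"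

definition mahalanobis_sq :: "real ^ 'd \<Rightarrow> real ^ 'd ^ 'd \<Rightarrow> real ^ 'd \<Rightarrow> real" where
  "mahalanobis_sq \<mu> \<Sigma> \<theta> = (\<theta> - \<mu>) \<bullet> (matrix_inv \<Sigma> *v (\<theta> - \<mu>))"

definition score ::
  "('g \<Rightarrow> real ^ 'd) \<Rightarrow> ('g \<Rightarrow> real ^ 'd) \<Rightarrow> ('g \<Rightarrow> real ^ 'd ^ 'd) \<Rightarrow> 'g \<Rightarrow> real" where
  "score target \<mu> \<Sigma> G = mahalanobis_sq (\<mu> G) (\<Sigma> G) (target G)"

definition trust_region ::
  "('g \<Rightarrow> real ^ 'd) \<Rightarrow> ('g \<Rightarrow> real ^ 'd ^ 'd) \<Rightarrow> ereal \<Rightarrow> 'g \<Rightarrow> (real ^ 'd) set" where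
  "trust_region \<mu> \<Sigma> q G = {\<theta>. ereal (mahalanobis_sq (\<mu> G) (\<Sigma> G) \<theta>) \<le> q}"

text \<open>
  The \<open>k\<close>-th smallest value, with multiplicity, for \<open>k \<ge> 1\<close>. If the list has fewer than \<open>k\<close>
  entries there is no such value, and the usual convention of conformal prediction puts it to \<open>\<infinity>\<close>.
\<close>

definition order_statistic :: "nat \<Rightarrow> real list \<Rightarrow> ereal" where
  "order_statistic k xs = (if k \<le> length xs then ereal (sort xs ! (k - 1)) else \<infinity>)"

definition exchangeable ::
  "'w measure \<Rightarrow> 'b measure \<Rightarrow> 'i set \<Rightarrow> ('i \<Rightarrow> 'w \<Rightarrow> 'b) \<Rightarrow> bool" where
  "exchangeable P S I X \<longleftrightarrow>
     (\<forall>i\<in>I. X i \<in> measurable P S) \<and>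
     (\<forall>\<pi>. \<pi> permutes I \<longrightarrow>
        distr P (PiM I (\<lambda>_. S)) (\<lambda>\<omega>. \<lambda>i\<in>I. X (\<pi> i) \<omega>) =
        distr P (PiM I (\<lambda>_. S)) (\<lambda>\<omega>. \<lambda>i\<in>I. X i \<omega>))"

end

theory Submission
  imports Defs
begin

text \<open>
  The new score is at most the conformal quantile iff fewer than \<open>k\<close> of all \<open>M + 1\<close> scores lie
  strictly below it. In any sample at least \<open>k\<close> of the indices have this property, and by
  exchangeability all indices have it with the same probability, which is therefore at least
  \<open>k / (M + 1)\<close>.
\<close>

text \<open>If some index is not of low rank, take one with least value among these. At least
  \<open>k\<close> indices lie strictly below it, and by minimality all of them are of low rank.
  Ties are harmless because only strict comparisons are counted.\<close>

lemma card_low_rank_ge: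
  fixes x :: "'i \<Rightarrow> 'a::linorder"
  assumes "finite I" and "k \<le> card I"
  shows "k \<le> card {j\<in>I. card {i\<in>I. x i < x j} < k}"
proof -
  define B where "B = {j\<in>I. card {i\<in>I. x i < x j} < k}"
  have fin: "finite B" using assms(1) by (simp add: B_def)
  have "k \<le> card B"
  proof (cases "B = I")
    case True
    then show ?thesis using assms(2) by simp
  next
    case False
    then have ne: "I - B \<noteq> {}" by (auto simp: B_def)
    define j where "j = arg_min_on x (I - B)"
    have j: "j \<in> I - B" and jmin: "\<And>i. i \<in> I - B \<Longrightarrow> x j \<le> x i"
      using ne assms(1) arg_min_if_finite(1)[of "I - B" x] arg_min_least[of "I - B" _ x]
      by (auto simp: j_def)
    have "k \<le> card {i\<in>I. x i < x j}"
      using j by (auto simp: B_def)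
    also have "\<dots> \<le> card B"
      using jmin by (intro card_mono fin) force
    finally show ?thesis .
  qed
  then show ?thesis by (simp add: B_def)
qed

text \<open>In a sorted list the entries below \<open>v\<close> occupy an initial segment of
  positions, and position \<open>n\<close> is outside it exactly when the segment has at most
  \<open>n\<close> elements.\<close>

lemma le_nth_sorted_iff:
  fixes ys :: "'a::linorder list"
  assumes "sorted ys" and "n < length ys"
  shows "v \<le> ys ! n \<longleftrightarrow> length (filter (\<lambda>y. y < v) ys) \<le> n"
proof
  assume v: "v \<le> ys ! n"
  have "{i. i < length ys \<and> ys ! i < v} \<subseteq> {..<n}"
  proof
    fix i assume "i \<in> {i. i < length ys \<and> ys ! i < v}"
    then have "i < length ys" "\<not> ys ! n \<le> ys ! i"
      using v by auto
    then show "i \<in> {..<n}"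
      using sorted_nth_mono[OF assms(1), of n i] by (cases "n \<le> i") auto
  qed
  from card_mono[OF _ this] show "length (filter (\<lambda>y. y < v) ys) \<le> n"
    by (simp add: length_filter_conv_card)
next
  assume le: "length (filter (\<lambda>y. y < v) ys) \<le> n"
  show "v \<le> ys ! n"
  proof (rule ccontr)
    assume "\<not> v \<le> ys ! n"
    then have "{..n} \<subseteq> {i. i < length ys \<and> ys ! i < v}"
      using assms by (auto intro: order_le_less_trans[OF sorted_nth_mono])
    from card_mono[OF _ this] show False
      using le by (simp add: length_filter_conv_card)
  qed
qed

lemma le_order_statistic_iff:
  assumes "1 \<le> k" and "k \<le> length xs + 1"
  shows "ereal v \<le> order_statistic k xs \<longleftrightarrow> length (filter (\<lambda>y. y < v) xs) < k"
proof (cases "k \<le> length xs")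
  case True
  then show ?thesis
    using assms(1) le_nth_sorted_iff[of "sort xs" "k - 1" v]
    by (auto simp: order_statistic_def filter_sort)
next
  \<comment> \<open>The order statistic is \<infinity> here, and a filtered list is no longer than
    \<open>xs\<close>, so both sides hold.\<close>
  case False
  then show ?thesis
    by (auto simp: order_statistic_def intro: le_less_trans[OF length_filter_le])
qed

text \<open>The joint law of the transformed family is the image of the original joint law under
  \<open>f\<close> applied coordinatewise, so equality of laws is inherited. This carries
  exchangeability from the pairs of graph and optimum to their scores.\<close>

lemma exchangeable_compose:
  assumes X: "exchangeable P S I X" and f[measurable]: "f \<in> measurable S T"
  shows "exchangeable P T I (\<lambda>i \<omega>. f (X i \<omega>))"
proof -
  have meas: "X i \<in> measurable P S" if "i \<in> I" for i
    using X that by (auto simp: exchangeable_def)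
  have F: "(\<lambda>x. \<lambda>i\<in>I. f (x i)) \<in> measurable (PiM I (\<lambda>_. S)) (PiM I (\<lambda>_. T))"
    by measurable
  have push: "distr P (PiM I (\<lambda>_. T)) (\<lambda>\<omega>. \<lambda>i\<in>I. f (X (\<pi> i) \<omega>)) =
      distr (distr P (PiM I (\<lambda>_. S)) (\<lambda>\<omega>. \<lambda>i\<in>I. X (\<pi> i) \<omega>)) (PiM I (\<lambda>_. T)) (\<lambda>x. \<lambda>i\<in>I. f (x i))"
    if "\<pi> permutes I" for \<pi>
  proof -
    have "(\<lambda>\<omega>. \<lambda>i\<in>I. X (\<pi> i) \<omega>) \<in> measurable P (PiM I (\<lambda>_. S))"
      using that by (intro measurable_restrict meas) (simp add: permutes_in_image)
    from distr_distr[OF F this] show ?thesis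
      by (simp add: comp_def cong: restrict_cong)
  qed
  show ?thesis
    unfolding exchangeable_def
  proof (intro conjI ballI allI impI)
    fix i assume "i \<in> I"
    then show "(\<lambda>\<omega>. f (X i \<omega>)) \<in> measurable P T"
      using meas by measurable
  next
    fix \<pi> assume p: "\<pi> permutes I"
    have "distr P (PiM I (\<lambda>_. S)) (\<lambda>\<omega>. \<lambda>i\<in>I. X (\<pi> i) \<omega>) =
        distr P (PiM I (\<lambda>_. S)) (\<lambda>\<omega>. \<lambda>i\<in>I. X i \<omega>)"
      using X p by (simp add: exchangeable_def)
    then show "distr P (PiM I (\<lambda>_. T)) (\<lambda>\<omega>. \<lambda>i\<in>I. f (X (\<pi> i) \<omega>)) =
        distr P (PiM I (\<lambda>_. T)) (\<lambda>\<omega>. \<lambda>i\<in>I. f (X i \<omega>))"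
      using push[OF p] push[OF permutes_id] by simp
  qed
qed

lemma measurable_rank:
  fixes x :: "'i \<Rightarrow> 'w \<Rightarrow> real"
  assumes "finite I" and "\<And>i. i \<in> I \<Longrightarrow> x i \<in> borel_measurable N" and "j \<in> I"
  shows "{\<omega>\<in>space N. card {i\<in>I. x i \<omega> < x j \<omega>} < k} \<in> sets N"
proof -
  \<comment> \<open>As a finite sum of indicators of comparisons, the rank is visibly
    measurable.\<close>
  have card_sum: "card {i\<in>I. x i \<omega> < x j \<omega>} = (\<Sum>i\<in>I. if x i \<omega> < x j \<omega> then 1 else 0)" for \<omega>
    using assms(1) by (simp add: sum.If_cases Int_def)
  note [measurable] = assms(2) assms(2)[OF assms(3)]
  show ?thesis
    unfolding card_sum by measurable
qed

text \<open>Swapping \<open>j\<close> and \<open>l\<close> leaves the joint law unchanged, and a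
  rank does not depend on how the other indices are labelled.\<close>

lemma exchangeable_rank_prob_eq:
  fixes X :: "'i \<Rightarrow> 'w \<Rightarrow> real"
  assumes X: "exchangeable P borel I X" and "finite I" and j: "j \<in> I" and l: "l \<in> I"
  shows "measure P {\<omega>\<in>space P. card {i\<in>I. X i \<omega> < X j \<omega>} < k} =
         measure P {\<omega>\<in>space P. card {i\<in>I. X i \<omega> < X l \<omega>} < k}"
proof -
  define N where "N = PiM I (\<lambda>_. borel :: real measure)"
  \<comment> \<open>The rank event of the fixed coordinate \<open>l\<close>, taken in the product
    space. Its preimage under the family permuted by \<pi> is the rank event of
    \<open>X (\<pi> l)\<close>.\<close>
  define E where "E = {x\<in>space N. card {i\<in>I. x i < x l} < k}"
  have E: "E \<in> sets N"
    unfolding E_def using assms(2) l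
    by (intro measurable_rank) (auto simp: N_def)
  have distr_E: "measure (distr P N (\<lambda>\<omega>. \<lambda>i\<in>I. X (\<pi> i) \<omega>)) E =
      measure P {\<omega>\<in>space P. card {i\<in>I. X (\<pi> i) \<omega> < X (\<pi> l) \<omega>} < k}"
    if p: "\<pi> permutes I" for \<pi>
  proof -
    have m: "(\<lambda>\<omega>. \<lambda>i\<in>I. X (\<pi> i) \<omega>) \<in> measurable P N"
      unfolding N_def using X p
      by (intro measurable_restrict) (simp add: exchangeable_def permutes_in_image)
    have "{i\<in>I. (\<lambda>i\<in>I. X (\<pi> i) \<omega>) i < (\<lambda>i\<in>I. X (\<pi> i) \<omega>) l} =
        {i\<in>I. X (\<pi> i) \<omega> < X (\<pi> l) \<omega>}" for \<omega>
      using l by auto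
    then have "(\<lambda>\<omega>. \<lambda>i\<in>I. X (\<pi> i) \<omega>) -` E \<inter> space P =
        {\<omega>\<in>space P. card {i\<in>I. X (\<pi> i) \<omega> < X (\<pi> l) \<omega>} < k}"
      using measurable_space[OF m] by (auto simp: E_def)
    then show ?thesis
      by (simp add: measure_distr[OF m E])
  qed
  define \<pi> where "\<pi> = Transposition.transpose j l"
  have p: "\<pi> permutes I"
    unfolding \<pi>_def using j l by (rule permutes_swap_id)
  \<comment> \<open>Here \<open>\<pi> l = j\<close>, and \<pi> maps the indices counted on the left
    bijectively onto those counted on the right.\<close>
  have reindex: "card {i\<in>I. X (\<pi> i) \<omega> < X (\<pi> l) \<omega>} = card {i\<in>I. X i \<omega> < X j \<omega>}" for \<omega>
  proof -
    have "{i\<in>\<pi> ` I. X i \<omega> < X j \<omega>} = \<pi> ` {i\<in>I. X (\<pi> i) \<omega> < X j \<omega>}"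
      by auto
    then have "{i\<in>I. X i \<omega> < X j \<omega>} = \<pi> ` {i\<in>I. X (\<pi> i) \<omega> < X j \<omega>}"
      by (simp only: permutes_image[OF p])
    moreover have "inj_on \<pi> {i\<in>I. X (\<pi> i) \<omega> < X j \<omega>}"
      using permutes_inj[OF p] by (rule inj_on_subset) simp
    ultimately show ?thesis
      by (simp add: card_image \<pi>_def)
  qed
  have "distr P N (\<lambda>\<omega>. \<lambda>i\<in>I. X (\<pi> i) \<omega>) = distr P N (\<lambda>\<omega>. \<lambda>i\<in>I. X i \<omega>)"
    using X p by (simp add: exchangeable_def N_def)
  with distr_E[OF p] distr_E[OF permutes_id] show ?thesis
    by (simp add: reindex)
qed

text \<open>The expected number of low-rank indices is at least \<open>k\<close>, since the bound
  holds at every sample point. By linearity it is also the sum of the probabilities of the events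
  \<open>A j\<close>, all equal to that of \<open>A l\<close>.\<close>

lemma exchangeable_rank_prob_ge:
  fixes X :: "'i \<Rightarrow> 'w \<Rightarrow> real"
  assumes "prob_space P" and X: "exchangeable P borel I X" and fin: "finite I" and l: "l \<in> I"
    and k: "k \<le> card I"
  shows "real k \<le> real (card I) * measure P {\<omega>\<in>space P. card {i\<in>I. X i \<omega> < X l \<omega>} < k}"
proof -
  interpret prob_space P by fact
  define A where "A j = {\<omega>\<in>space P. card {i\<in>I. X i \<omega> < X j \<omega>} < k}" for j
  have A[measurable]: "A j \<in> sets P" if "j \<in> I" for j
    unfolding A_def using X fin that
    by (intro measurable_rank) (auto simp: exchangeable_def)
  have pointwise: "real k \<le> (\<Sum>j\<in>I. indicator (A j) \<omega>)" if "\<omega> \<in> space P" for \<omega>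
  proof -
    have "(\<Sum>j\<in>I. indicator (A j) \<omega> :: real) = real (card {j\<in>I. card {i\<in>I. X i \<omega> < X j \<omega>} < k})"
      using fin that by (simp add: A_def indicator_def sum.If_cases Int_def)
    then show ?thesis
      using card_low_rank_ge[OF fin k, of "\<lambda>i. X i \<omega>"] by simp
  qed
  have int: "integrable P (\<lambda>\<omega>. \<Sum>j\<in>I. indicator (A j) \<omega> :: real)"
    using A by (intro Bochner_Integration.integrable_sum) (simp add: less_top[symmetric])
  have "real k = (\<integral>\<omega>. real k \<partial>P)"
    by (simp add: prob_space)
  also have "\<dots> \<le> (\<integral>\<omega>. (\<Sum>j\<in>I. indicator (A j) \<omega>) \<partial>P)"
    using int pointwise by (intro integral_mono) auto
  also have "\<dots> = (\<Sum>j\<in>I. prob (A j))"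
    using A by (subst Bochner_Integration.integral_sum) (auto simp: less_top[symmetric])
  also have "\<dots> = (\<Sum>j\<in>I. prob (A l))"
    unfolding A_def using exchangeable_rank_prob_eq[OF X fin _ l] by (intro sum.cong) auto
  finally show ?thesis
    by (simp add: A_def)
qed

theorem conformal_coverage:
  fixes X :: "nat \<Rightarrow> 'w \<Rightarrow> real"
  assumes "prob_space P" and "exchangeable P borel {1..M + 1} X"
    and "1 \<le> k" and "k \<le> M + 1"
  shows "real k / (real M + 1) \<le>
    measure P {\<omega>\<in>space P. ereal (X (M + 1) \<omega>) \<le> order_statistic k (map (\<lambda>i. X i \<omega>) [1..<M + 1])}"
proof -
  have "ereal (X (M + 1) \<omega>) \<le> order_statistic k (map (\<lambda>i. X i \<omega>) [1..<M + 1]) \<longleftrightarrow>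
      card {i\<in>{1..M + 1}. X i \<omega> < X (M + 1) \<omega>} < k" for \<omega>
  proof -
    have "length (filter (\<lambda>y. y < X (M + 1) \<omega>) (map (\<lambda>i. X i \<omega>) [1..<M + 1])) =
        card ({i. X i \<omega> < X (M + 1) \<omega>} \<inter> {1..<M + 1})"
      by (simp add: filter_map comp_def distinct_length_filter del: upt_Suc)
    \<comment> \<open>The new score is not strictly below itself, so ranking it against the
      \<open>M\<close> calibration scores or against all \<open>M + 1\<close> gives the same
      count.\<close>
    also have "{i. X i \<omega> < X (M + 1) \<omega>} \<inter> {1..<M + 1} =
        {i\<in>{1..M + 1}. X i \<omega> < X (M + 1) \<omega>}"
      by (auto simp: less_Suc_eq_le le_less)
    finally show ?thesis
      using assms(3,4) by (subst le_order_statistic_iff) auto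
  qed
  moreover have "real k \<le> real (card {1..M + 1}) *
      measure P {\<omega>\<in>space P. card {i\<in>{1..M + 1}. X i \<omega> < X (M + 1) \<omega>} < k}"
    using assms by (intro exchangeable_rank_prob_ge) auto
  ultimately show ?thesis
    by (simp add: divide_le_eq mult.commute add.commute)
qed

theorem proposition14:
  fixes P :: "'w measure"
    and G :: "nat \<Rightarrow> 'w \<Rightarrow> ugraph"
    and nm :: "'p::{finite,linorder} angles nm_config"
    and \<mu> :: "ugraph \<Rightarrow> 'p angles"
    and \<Sigma> :: "ugraph \<Rightarrow> real ^ ('p + 'p) ^ ('p + 'p)"
    and M :: nat
    and \<alpha> :: real
  assumes "prob_space P"
    and "valid_nm_config nm"
    and "\<And>g. g \<in> graphs \<Longrightarrow> sym_pos_def (\<Sigma> g)"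
    and "0 < \<alpha>" and "\<alpha> < 1"
    and "exchangeable P (count_space graphs \<Otimes>\<^sub>M borel) {1..M + 1}
           (\<lambda>i \<omega>. (G i \<omega>, target_optimum nm (G i \<omega>)))"
  shows "measure P {\<omega> \<in> space P.
           let k = nat \<lceil>(real M + 1) * (1 - \<alpha>)\<rceil>;
               q = order_statistic k
                     (map (\<lambda>i. score (target_optimum nm) \<mu> \<Sigma> (G i \<omega>)) [1..<M + 1])
           in target_optimum nm (G (M + 1) \<omega>) \<in> trust_region \<mu> \<Sigma> q (G (M + 1) \<omega>)}
         \<ge> 1 - \<alpha>"
proof -
  define k where "k = nat \<lceil>(real M + 1) * (1 - \<alpha>)\<rceil>"
  define s where "s = score (target_optimum nm) \<mu> \<Sigma>"
  \<comment> \<open>Both bounds survive rounding up: a positive number has ceiling at least 1, and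
    the upper bound \<open>M + 1\<close> is an integer. The case \<open>k = M + 1\<close> does
    occur, for small \<alpha>, and then the quantile is \<infinity>.\<close>
  have "0 < (real M + 1) * (1 - \<alpha>)"
    using assms(5) by simp
  moreover have "(real M + 1) * (1 - \<alpha>) \<le> real M + 1"
    using assms(4) by (simp add: mult_le_cancel_left1)
  ultimately have k: "1 \<le> k" "k \<le> M + 1" and k_ge: "(real M + 1) * (1 - \<alpha>) \<le> real k"
    unfolding k_def by linarith+
  \<comment> \<open>Graphs carry the discrete sigma-algebra, so any real function of a graph is
    measurable, including one built from the optimizer and the predictor.\<close>
  have "s \<in> measurable (count_space graphs) borel"
    by simp
  \<comment> \<open>The target optimum is a function of the graph, so the score of a pair can be
    read off its first component.\<close>
  then have "(\<lambda>p. s (fst p)) \<in> measurable (count_space graphs \<Otimes>\<^sub>M borel) borel"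
    by (rule measurable_compose[OF measurable_fst])
  from exchangeable_compose[OF assms(6) this]
  have "exchangeable P borel {1..M + 1} (\<lambda>i \<omega>. s (G i \<omega>))"
    by simp
  from conformal_coverage[OF assms(1) this k]
  have "real k / (real M + 1) \<le> measure P {\<omega>\<in>space P. ereal (s (G (M + 1) \<omega>)) \<le>
      order_statistic k (map (\<lambda>i. s (G i \<omega>)) [1..<M + 1])}" .
  moreover have "1 - \<alpha> \<le> real k / (real M + 1)"
    using k_ge by (simp add: le_divide_eq mult.commute)
  \<comment> \<open>By definition, the target lies in the trust region exactly when its score is at
    most the quantile.\<close>
  ultimately show ?thesis
    by (simp add: k_def s_def score_def trust_region_def Let_def del: upt_Suc)
qed

end
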